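(* Let $\{f_\theta:\theta\in\Theta\}$ be a single statistical model for the data $x$, let $\pi_1,\ldots,\pi_k$ be prior densities on $\Theta$, and let $\alpha\in S_k$ with $\alpha_i>0$ for all $i$. Let $RB_{1,\alpha}(\cdot\,|\,x)$ be the relative belief ratio based on the linear pooling prior $\pi_{1,\alpha}=\sum_{i=1}^k\alpha_i\pi_i$. Then: (i) $RB_{1,\alpha}$ is consensus preserving; (ii) whenever $RB_i(\theta\,|\,x)\le 1$ for all $i$, or $RB_i(\theta\,|\,x)\ge 1$ for all $i$, then $RB_{1,\alpha}(\theta\,|\,x)=1$ if and only if $RB_i(\theta\,|\,x)=1$ for all $i$.
   Context: $S_k=\{\alpha\in[0,1]^k:\sum_i\alpha_i=1\}$. Densities on $\Theta$ are with respect to a fixed support measure $d\theta$. The relative belief ratio of $\theta$ based on a prior $\pi$ is the ratio of posterior to prior density, $RB(\theta\,|\,x)=\pi(\theta\,|\,x)/\pi(\theta)$ with $\pi(\theta\,|\,x)=f_\theta(x)\pi(\theta)/m(x)$ and $m(x)=\int_\Theta f_\theta(x)\pi(\theta)\,d\theta$; at points with $\pi(\theta)=0$ it is taken to be $f_\theta(x)/m(x)$, the value the ratio has wherever $\pi(\theta)>0$. $RB_i$ is the relative belief ratio based on $\pi_i$, and the prior predictives $m_i(x)=\int_\Theta f_\theta(x)\pi_i(\theta)\,d\theta$ are assumed positive and finite at the observed $x$. There is evidence in favor of the value $\theta$ if $RB(\theta\,|\,x)>1$, evidence against $\theta$ if $RB(\theta\,|\,x)<1$, and no evidence either way if $RB(\theta\,|\,x)=1$.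 The $i$-th inference base consists of the data $x$, the model, and the prior $\pi_i$, and it expresses evidence via $RB_i$. A rule for combining evidence about a parameter is called consensus preserving if: whenever at least one inference base indicates evidence in favor of (respectively, against) a value of the parameter and the remaining inference bases do not give evidence against (respectively, in favor of) it, then the rule gives evidence in favor of (respectively, against) that value; and if no inference base indicates evidence one way or the other about a value, then neither does the combination. *)

theory Defs
  imports "HOL-Probability.Probability"
begin

text \<open>
  The parameter space \<open>\<Theta>\<close> with its support measure is a measure \<open>M\<close>, with \<open>\<Theta> = space M\<close>;
  the sample space with its support measure is a measure \<open>N\<close>. Densities are real-valued functions.
\<close>

definition prob_density :: "'a measure \<Rightarrow> ('a \<Rightarrow> real) \<Rightarrow> bool" where
  "prob_density M p \<longleftrightarrow>
     p \<in> borel_measurable M \<and> (\<forall>\<theta>\<in>space M. 0 \<le> p \<theta>) \<and>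
     prob_space (density M (\<lambda>\<theta>. ennreal (p \<theta>)))"

definition statistical_model :: "'x measure \<Rightarrow> 'a measure \<Rightarrow> ('a \<Rightarrow> 'x \<Rightarrow> real) \<Rightarrow> bool" where
  "statistical_model N M f \<longleftrightarrow> (\<forall>\<theta>\<in>space M. prob_density N (f \<theta>))"

definition prior_predictive :: "'a measure \<Rightarrow> ('a \<Rightarrow> 'x \<Rightarrow> real) \<Rightarrow> ('a \<Rightarrow> real) \<Rightarrow> 'x \<Rightarrow> real" where
  "prior_predictive M f p x = (LINT \<theta>|M. f \<theta> x * p \<theta>)"

text \<open>
  The Bochner integral is \<open>0\<close> on non-integrable functions; for the nonnegative integrand here,
  integrability is what makes the prior predictive well defined and finite.
\<close>

definition prior_predictive_pos_finite ::
    "'a measure \<Rightarrow> ('a \<Rightarrow> 'x \<Rightarrow> real) \<Rightarrow> ('a \<Rightarrow> real) \<Rightarrow> 'x \<Rightarrow> bool" where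
  "prior_predictive_pos_finite M f p x \<longleftrightarrow>
     integrable M (\<lambda>\<theta>. f \<theta> x * p \<theta>) \<and> 0 < prior_predictive M f p x"

definition posterior :: "'a measure \<Rightarrow> ('a \<Rightarrow> 'x \<Rightarrow> real) \<Rightarrow> ('a \<Rightarrow> real) \<Rightarrow> 'x \<Rightarrow> 'a \<Rightarrow> real" where
  "posterior M f p x \<theta> = f \<theta> x * p \<theta> / prior_predictive M f p x"

definition relative_belief ::
    "'a measure \<Rightarrow> ('a \<Rightarrow> 'x \<Rightarrow> real) \<Rightarrow> ('a \<Rightarrow> real) \<Rightarrow> 'x \<Rightarrow> 'a \<Rightarrow> real" where
  "relative_belief M f p x \<theta> =
     (if p \<theta> = 0 then f \<theta> x / prior_predictive M f p x else posterior M f p x \<theta> / p \<theta>)"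

definition weight_simplex :: "nat \<Rightarrow> (nat \<Rightarrow> real) set" where
  "weight_simplex k = {\<alpha> \<in> {1..k} \<rightarrow> {0..1}. (\<Sum>i\<in>{1..k}. \<alpha> i) = 1}"

definition linear_pool :: "nat \<Rightarrow> (nat \<Rightarrow> real) \<Rightarrow> (nat \<Rightarrow> 'a \<Rightarrow> real) \<Rightarrow> 'a \<Rightarrow> real" where
  "linear_pool k \<alpha> p \<theta> = (\<Sum>i\<in>{1..k}. \<alpha> i * p i \<theta>)"

definition evidence_for :: "('a \<Rightarrow> real) \<Rightarrow> 'a \<Rightarrow> bool" where
  "evidence_for rb \<theta> \<longleftrightarrow> rb \<theta> > 1"

definition evidence_against :: "('a \<Rightarrow> real) \<Rightarrow> 'a \<Rightarrow> bool" where
  "evidence_against rb \<theta> \<longleftrightarrow> rb \<theta> < 1"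

definition no_evidence :: "('a \<Rightarrow> real) \<Rightarrow> 'a \<Rightarrow> bool" where
  "no_evidence rb \<theta> \<longleftrightarrow> rb \<theta> = 1"

text \<open>
  \<open>RB i\<close> is the relative belief ratio by which the \<open>i\<close>-th inference base, \<open>i \<in> {1..k}\<close>, expresses
  evidence, and \<open>rb\<close> is the ratio by which the combination does, for parameter values in \<open>T\<close>.
\<close>

definition consensus_preserving ::
    "'a set \<Rightarrow> nat \<Rightarrow> (nat \<Rightarrow> 'a \<Rightarrow> real) \<Rightarrow> ('a \<Rightarrow> real) \<Rightarrow> bool" where
  "consensus_preserving T k RB rb \<longleftrightarrow>
     (\<forall>\<theta>\<in>T.
        ((\<exists>i\<in>{1..k}. evidence_for (RB i) \<theta> \<and>
            (\<forall>j\<in>{1..k} - {i}. \<not> evidence_against (RB j) \<theta>)) \<longrightarrow> evidence_for rb \<theta>) \<and>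
        ((\<exists>i\<in>{1..k}. evidence_against (RB i) \<theta> \<and>
            (\<forall>j\<in>{1..k} - {i}. \<not> evidence_for (RB j) \<theta>)) \<longrightarrow> evidence_against rb \<theta>) \<and>
        ((\<forall>i\<in>{1..k}. no_evidence (RB i) \<theta>) \<longrightarrow> no_evidence rb \<theta>))"

end

theory Submission
  imports Defs
begin

text \<open>
  The ratio of posterior to prior cancels the prior: at every \<open>\<theta>\<close> the relative belief ratio is
  \<open>f\<^sub>\<theta>(x)\<close> divided by the prior predictive at \<open>x\<close>. Since there is only one model, the ratios
  of all inference bases and of the pool have the same numerator, and each kind of evidence is a
  comparison of the number \<open>f\<^sub>\<theta>(x)\<close> with a prior predictive: evidence in favor means that
  \<open>f\<^sub>\<theta>(x)\<close> is the larger, evidence against that it is the smaller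
  (lemma \<open>relative_belief_compare_1\<close>).

  The prior predictive is linear in the prior, so the one of the linear pool is
  \<open>\<Sum>\<^sub>i \<alpha>\<^sub>i m\<^sub>i(x)\<close>, the mean of the individual ones with the pooling weights
  (lemma \<open>prior_predictive_linear_pool\<close>). The assertion is therefore about the position of a mean
  relative to a number: if all \<open>m\<^sub>i(x)\<close> lie weakly on one side of \<open>f\<^sub>\<theta>(x)\<close>, so does
  their mean, and because every weight is positive the mean is strictly on that side as soon as
  one of them is (lemmas \<open>weighted_mean_less\<close> and \<open>weighted_mean_greater\<close>).
\<close>

lemma weighted_mean_less:
  fixes w m :: "'i \<Rightarrow> real"
  assumes "finite I" and "sum w I = 1" and "\<And>i. i \<in> I \<Longrightarrow> 0 < w i"
    and "\<And>i. i \<in> I \<Longrightarrow> m i \<le> c" and "\<exists>i\<in>I. m i < c"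
  shows "(\<Sum>i\<in>I. w i * m i) < c"
proof -
  have "(\<Sum>i\<in>I. w i * m i) < (\<Sum>i\<in>I. w i * c)"
    using assms by (intro sum_strict_mono_ex1) (auto intro!: mult_left_mono less_imp_le)
  also have "\<dots> = c"
    using assms(2) by (simp flip: sum_distrib_right)
  finally show ?thesis .
qed

lemma weighted_mean_greater:
  fixes w m :: "'i \<Rightarrow> real"
  assumes "finite I" and "sum w I = 1" and "\<And>i. i \<in> I \<Longrightarrow> 0 < w i"
    and "\<And>i. i \<in> I \<Longrightarrow> c \<le> m i" and "\<exists>i\<in>I. c < m i"
  shows "c < (\<Sum>i\<in>I. w i * m i)"
  using weighted_mean_less[of I w "\<lambda>i. - m i" "- c"] assms by (simp add: sum_negf)

text \<open>
  Where the prior density vanishes, the convention for the ratio gives the same quotient, so no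
  exceptional parameter values remain.
\<close>

lemma relative_belief_eq:
  "relative_belief M f p x \<theta> = f \<theta> x / prior_predictive M f p x"
  by (simp add: relative_belief_def posterior_def)

lemma relative_belief_compare_1:
  assumes "0 < prior_predictive M f p x"
  shows "relative_belief M f p x \<theta> < 1 \<longleftrightarrow> f \<theta> x < prior_predictive M f p x"
    and "relative_belief M f p x \<theta> > 1 \<longleftrightarrow> prior_predictive M f p x < f \<theta> x"
    and "relative_belief M f p x \<theta> \<le> 1 \<longleftrightarrow> f \<theta> x \<le> prior_predictive M f p x"
    and "relative_belief M f p x \<theta> \<ge> 1 \<longleftrightarrow> prior_predictive M f p x \<le> f \<theta> x"
    and "relative_belief M f p x \<theta> = 1 \<longleftrightarrow> prior_predictive M f p x = f \<theta> x"
  using assms by (auto simp: relative_belief_eq field_simps)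

lemma prior_predictive_linear_pool:
  assumes "\<And>i. i \<in> {1..k} \<Longrightarrow> integrable M (\<lambda>\<theta>. f \<theta> x * p i \<theta>)"
  shows "prior_predictive M f (linear_pool k \<alpha> p) x =
    (\<Sum>i\<in>{1..k}. \<alpha> i * prior_predictive M f (p i) x)"
proof -
  have "prior_predictive M f (linear_pool k \<alpha> p) x =
      (LINT \<theta>|M. (\<Sum>i\<in>{1..k}. \<alpha> i * (f \<theta> x * p i \<theta>)))"
    by (simp add: prior_predictive_def linear_pool_def sum_distrib_left mult.left_commute)
  also have "\<dots> = (\<Sum>i\<in>{1..k}. LINT \<theta>|M. \<alpha> i * (f \<theta> x * p i \<theta>))"
    using assms by (intro Bochner_Integration.integral_sum integrable_mult_right) auto
  finally show ?thesis
    by (simp add: prior_predictive_def)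
qed

theorem proposition4:
  fixes M :: "'a measure" and N :: "'x measure"
    and f :: "'a \<Rightarrow> 'x \<Rightarrow> real" and x :: 'x
    and k :: nat and \<pi> :: "nat \<Rightarrow> 'a \<Rightarrow> real" and \<alpha> :: "nat \<Rightarrow> real"
  assumes model: "statistical_model N M f"
    and data: "x \<in> space N"
    and priors: "\<And>i. i \<in> {1..k} \<Longrightarrow> prob_density M (\<pi> i)"
    and predictives: "\<And>i. i \<in> {1..k} \<Longrightarrow> prior_predictive_pos_finite M f (\<pi> i) x"
    and simplex: "\<alpha> \<in> weight_simplex k"
    and positive: "\<And>i. i \<in> {1..k} \<Longrightarrow> \<alpha> i > 0"
  shows "consensus_preserving (space M) k
           (\<lambda>i. relative_belief M f (\<pi> i) x) (relative_belief M f (linear_pool k \<alpha> \<pi>) x) \<and>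
         (\<forall>\<theta>\<in>space M.
           (\<forall>i\<in>{1..k}. relative_belief M f (\<pi> i) x \<theta> \<le> 1) \<or>
           (\<forall>i\<in>{1..k}. relative_belief M f (\<pi> i) x \<theta> \<ge> 1) \<longrightarrow>
           (relative_belief M f (linear_pool k \<alpha> \<pi>) x \<theta> = 1 \<longleftrightarrow>
            (\<forall>i\<in>{1..k}. relative_belief M f (\<pi> i) x \<theta> = 1)))"
proof -
  let ?m = "\<lambda>i. prior_predictive M f (\<pi> i) x"
  let ?RB = "\<lambda>i. relative_belief M f (\<pi> i) x"
  let ?rb = "relative_belief M f (linear_pool k \<alpha> \<pi>) x"
  have m_pos: "0 < ?m i" if "i \<in> {1..k}" for i
    using predictives[OF that] by (simp add: prior_predictive_pos_finite_def)
  have pool: "prior_predictive M f (linear_pool k \<alpha> \<pi>) x = (\<Sum>i\<in>{1..k}. \<alpha> i * ?m i)"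
    using predictives
    by (intro prior_predictive_linear_pool) (simp add: prior_predictive_pos_finite_def)
  have weights: "sum \<alpha> {1..k} = 1"
    using simplex by (simp add: weight_simplex_def)
  \<comment> \<open>The weights sum to \<open>1\<close>, so there is at least one inference base; otherwise the predictive of
    the pool would be \<open>0\<close> and its ratio meaningless.\<close>
  have "{1..k} \<noteq> {}"
    using weights by force
  then have pool_pos: "0 < prior_predictive M f (linear_pool k \<alpha> \<pi>) x"
    unfolding pool using positive m_pos by (intro sum_pos) auto
  note compare = relative_belief_compare_1[OF m_pos] relative_belief_compare_1[OF pool_pos]

  have favor: "?rb \<theta> > 1"
    if "\<forall>i\<in>{1..k}. ?RB i \<theta> \<ge> 1" and "\<exists>i\<in>{1..k}. ?RB i \<theta> > 1" for \<theta>
    using that weighted_mean_less[of "{1..k}" \<alpha> ?m "f \<theta> x"] weights positive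
    by (simp add: compare pool)
  have against: "?rb \<theta> < 1"
    if "\<forall>i\<in>{1..k}. ?RB i \<theta> \<le> 1" and "\<exists>i\<in>{1..k}. ?RB i \<theta> < 1" for \<theta>
    using that weighted_mean_greater[of "{1..k}" \<alpha> "f \<theta> x" ?m] weights positive
    by (simp add: compare pool)
  have neutral: "?rb \<theta> = 1" if "\<forall>i\<in>{1..k}. ?RB i \<theta> = 1" for \<theta>
  proof -
    have "(\<Sum>i\<in>{1..k}. \<alpha> i * ?m i) = (\<Sum>i\<in>{1..k}. \<alpha> i * f \<theta> x)"
      using that by (intro sum.cong) (simp_all add: compare)
    also have "\<dots> = f \<theta> x"
      using weights by (simp flip: sum_distrib_right)
    finally show ?thesis
      by (simp add: compare pool)
  qed

  have "consensus_preserving (space M) k ?RB ?rb"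
    unfolding consensus_preserving_def evidence_for_def evidence_against_def no_evidence_def
  proof (intro ballI conjI impI)
    fix \<theta>
    assume "\<exists>i\<in>{1..k}. ?RB i \<theta> > 1 \<and> (\<forall>j\<in>{1..k} - {i}. \<not> ?RB j \<theta> < 1)"
    then show "?rb \<theta> > 1"
      by (intro favor) (force simp: not_less)+
  next
    fix \<theta>
    assume "\<exists>i\<in>{1..k}. ?RB i \<theta> < 1 \<and> (\<forall>j\<in>{1..k} - {i}. \<not> ?RB j \<theta> > 1)"
    then show "?rb \<theta> < 1"
      by (intro against) (force simp: not_less)+
  next
    fix \<theta>
    assume "\<forall>i\<in>{1..k}. ?RB i \<theta> = 1"
    then show "?rb \<theta> = 1"
      by (rule neutral)
  qed
  moreover have "?rb \<theta> = 1 \<longleftrightarrow> (\<forall>i\<in>{1..k}. ?RB i \<theta> = 1)"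
    if "(\<forall>i\<in>{1..k}. ?RB i \<theta> \<le> 1) \<or> (\<forall>i\<in>{1..k}. ?RB i \<theta> \<ge> 1)" for \<theta>
    using that
  proof
    assume "\<forall>i\<in>{1..k}. ?RB i \<theta> \<le> 1"
    then show ?thesis
      using against[of \<theta>] neutral[of \<theta>] by (metis less_irrefl less_le)
  next
    assume "\<forall>i\<in>{1..k}. ?RB i \<theta> \<ge> 1"
    then show ?thesis
      using favor[of \<theta>] neutral[of \<theta>] by (metis less_irrefl less_le)
  qed
  ultimately show ?thesis
    by blast
qed

end
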